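(* Let $k\ge 4$ be an integer. The following two statements are equivalent: (a) every $k$-wise intersecting clutter is non-ideal (i.e. not ideal); (b) every ideal clutter without a member of cardinality at most one has chromatic number at most $k$.
   Context: Let $V$ be a finite set of elements. A family $\mathcal{C}$ of subsets of $V$ (called members) is a clutter over ground set $V$ if no member contains another one. $\mathcal{C}$ is ideal if for every $w\in\mathbb{Z}^V_+$ the linear program $\min\{w^\top x : \sum_{u\in C}x_u\ge 1\ \forall C\in\mathcal{C},\ x\ge \mathbf{0}\}$ has an integral optimal solution. $\mathcal{C}$ is $k$-wise intersecting if every subset of at most $k$ members have a common element (in $V$), yet no element of $V$ belongs to all members. For a clutter $\mathcal{C}$ where every member has cardinality at least two and an integer $k\ge 2$, a proper $k$-colouring of $\mathcal{C}$ is an assignment of $k$ colours to the elements of $V$ (not all colours need be used) such that no member is monochromatic, i.e. a partition of $V$ into $k$ (possibly empty) parts none of which contains a member. The chromatic number $\chi(\mathcal{C})$ is the smallest integer $k\ge 2$ such that a proper $k$-colouring exists. *)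

theory Defs
  imports Complex_Main
begin

definition clutter :: "'a set \<Rightarrow> 'a set set \<Rightarrow> bool" where
  "clutter V \<C> \<longleftrightarrow> finite V \<and> \<C> \<subseteq> Pow V \<and> (\<forall>A\<in>\<C>. \<forall>B\<in>\<C>. A \<subseteq> B \<longrightarrow> A = B)"

(* Vectors indexed by V are total functions; their values outside V are irrelevant throughout. *)
definition covering_feasible :: "'a set \<Rightarrow> 'a set set \<Rightarrow> ('a \<Rightarrow> real) \<Rightarrow> bool" where
  "covering_feasible V \<C> x \<longleftrightarrow> (\<forall>A\<in>\<C>. (\<Sum>u\<in>A. x u) \<ge> 1) \<and> (\<forall>u\<in>V. x u \<ge> 0)"

definition covering_optimal ::
  "'a set \<Rightarrow> 'a set set \<Rightarrow> ('a \<Rightarrow> int) \<Rightarrow> ('a \<Rightarrow> real) \<Rightarrow> bool" where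
  "covering_optimal V \<C> w x \<longleftrightarrow> covering_feasible V \<C> x \<and>
     (\<forall>y. covering_feasible V \<C> y \<longrightarrow>
        (\<Sum>u\<in>V. of_int (w u) * x u) \<le> (\<Sum>u\<in>V. of_int (w u) * y u))"

(* If the empty set is a member, the linear program is infeasible, so the family is not ideal
   in this sense. *)
definition ideal_clutter :: "'a set \<Rightarrow> 'a set set \<Rightarrow> bool" where
  "ideal_clutter V \<C> \<longleftrightarrow>
     (\<forall>w. (\<forall>u\<in>V. w u \<ge> 0) \<longrightarrow> (\<exists>x. covering_optimal V \<C> w x \<and> (\<forall>u\<in>V. x u \<in> \<int>)))"

(* The subfamily S may be empty; the common element is always sought in V. *)
definition kwise_intersecting :: "nat \<Rightarrow> 'a set \<Rightarrow> 'a set set \<Rightarrow> bool" where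
  "kwise_intersecting k V \<C> \<longleftrightarrow>
     (\<forall>S. S \<subseteq> \<C> \<and> finite S \<and> card S \<le> k \<longrightarrow> (\<exists>v\<in>V. \<forall>A\<in>S. v \<in> A)) \<and>
     \<not> (\<exists>v\<in>V. \<forall>A\<in>\<C>. v \<in> A)"

definition proper_colouring :: "nat \<Rightarrow> 'a set \<Rightarrow> 'a set set \<Rightarrow> ('a \<Rightarrow> nat) \<Rightarrow> bool" where
  "proper_colouring k V \<C> f \<longleftrightarrow>
     (\<forall>v\<in>V. f v < k) \<and> (\<forall>A\<in>\<C>. \<not> (\<exists>c<k. \<forall>v\<in>A. f v = c))"

(* Meaningful only if every member has at least two elements: otherwise no proper colouring
   exists and the least number is unspecified. *)
definition chromatic_number :: "'a set \<Rightarrow> 'a set set \<Rightarrow> nat" where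
  "chromatic_number V \<C> = (LEAST k. k \<ge> 2 \<and> (\<exists>f. proper_colouring k V \<C> f))"

end

theory Submission
  imports Defs
begin

text \<open>
  The two statements are exchanged by passing from a clutter \<open>\<C>\<close> to its blocker \<open>b(\<C>)\<close>, the
  clutter of its minimal covers, on the same ground set.

  A subset \<open>U\<close> of \<open>V\<close> contains no minimal cover exactly if some member avoids it. Hence a proper
  \<open>k\<close>-colouring of \<open>b(\<C>)\<close> yields at most \<open>k\<close> members of \<open>\<C>\<close> without a common element, one
  member avoiding each colour class (\<open>kwise_intersecting_not_colourable\<close>). In the other
  direction, \<open>k\<close> members of \<open>b(\<C>)\<close> without a common element give a proper \<open>k\<close>-colouring of \<open>\<C>\<close>:
  their complements cover \<open>V\<close>, and none of them contains a member of \<open>\<C>\<close>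
  (\<open>blocker_kwise_intersecting\<close>). Finally, if an element is common to all members of one of the
  two clutters, then the other one has a member of cardinality at most one.

  It remains to see that the blocker of an ideal clutter is ideal (Lehman). If \<open>w\<close> is feasible for \<open>\<C>\<close> and \<open>x\<close> is feasible for \<open>b(\<C>)\<close>, regard \<open>x\<close> as a
  weight function for the covering problem of \<open>\<C>\<close>: by idealness the value of \<open>w\<close> is at least the
  weight of some minimal cover, which is at least 1. So \<open>\<Sum>u\<in>V. x u * w u \<ge> 1\<close>
  (\<open>ideal_clutter_feasible_product\<close>), and this inequality, symmetric in the two clutters, says
  after scaling that some member of \<open>\<C>\<close> is optimal for the covering problem of \<open>b(\<C>)\<close>
  (\<open>ideal_clutter_blocker\<close>).
\<close>

section \<open>Covers and the blocker\<close>

definition cover :: "'a set \<Rightarrow> 'a set set \<Rightarrow> 'a set \<Rightarrow> bool" where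
  "cover V \<C> B \<longleftrightarrow> B \<subseteq> V \<and> (\<forall>A\<in>\<C>. A \<inter> B \<noteq> {})"

definition blocker :: "'a set \<Rightarrow> 'a set set \<Rightarrow> 'a set set" where
  "blocker V \<C> = {B. cover V \<C> B \<and> (\<forall>D. cover V \<C> D \<and> D \<subseteq> B \<longrightarrow> D = B)}"

lemma blocker_imp_cover: "B \<in> blocker V \<C> \<Longrightarrow> cover V \<C> B"
  by (simp add: blocker_def)

lemma cover_contains_blocker_member:
  assumes "finite V" "cover V \<C> U"
  obtains B where "B \<in> blocker V \<C>" "B \<subseteq> U"
proof -
  have "finite {B. cover V \<C> B}"
    by (rule finite_subset[of _ "Pow V"]) (use assms in \<open>auto simp: cover_def\<close>)
  from finite_has_minimal2[OF this, of U] assms(2)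
  obtain B where "cover V \<C> B" "B \<subseteq> U" "\<forall>D. cover V \<C> D \<longrightarrow> D \<subseteq> B \<longrightarrow> B = D"
    by auto
  then show thesis
    by (intro that[of B]) (auto simp: blocker_def)
qed

lemma no_blocker_member_imp_disjoint_member:
  assumes "finite V" "U \<subseteq> V" "\<not> (\<exists>B\<in>blocker V \<C>. B \<subseteq> U)"
  obtains A where "A \<in> \<C>" "A \<inter> U = {}"
proof -
  have "\<not> cover V \<C> U"
    using assms cover_contains_blocker_member by metis
  then show thesis
    using assms(2) that by (auto simp: cover_def)
qed

lemma clutter_blocker: "finite V \<Longrightarrow> clutter V (blocker V \<C>)"
  by (auto simp: clutter_def blocker_def cover_def)

section \<open>The blocker of an ideal clutter\<close>

lemma ideal_clutter_min_cover_bound: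
  fixes c :: "'a \<Rightarrow> int"
  assumes "clutter V \<C>" "ideal_clutter V \<C>" "\<forall>u\<in>V. c u \<ge> 0" "covering_feasible V \<C> w"
  obtains B where "B \<in> blocker V \<C>" "(\<Sum>u\<in>B. of_int (c u)) \<le> (\<Sum>u\<in>V. of_int (c u) * w u)"
proof -
  have fin: "finite V" and sub: "\<And>A. A \<in> \<C> \<Longrightarrow> A \<subseteq> V"
    using assms(1) by (auto simp: clutter_def)
  obtain x where x: "covering_optimal V \<C> c x" "\<forall>u\<in>V. x u \<in> \<int>"
    using assms(2,3) by (auto simp: ideal_clutter_def)
  have feas: "covering_feasible V \<C> x"
    using x(1) by (simp add: covering_optimal_def)
  let ?U = "{u\<in>V. x u > 0}"
  have "cover V \<C> ?U"
    unfolding cover_def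
  proof (intro conjI ballI notI)
    fix A assume A: "A \<in> \<C>" "A \<inter> ?U = {}"
    then have "(\<Sum>u\<in>A. x u) \<le> 0"
      using sub[OF A(1)] by (intro sum_nonpos) force
    moreover have "(\<Sum>u\<in>A. x u) \<ge> 1"
      using feas A(1) by (simp add: covering_feasible_def)
    ultimately show False by simp
  qed auto
  then obtain B where B: "B \<in> blocker V \<C>" "B \<subseteq> ?U"
    using cover_contains_blocker_member[OF fin] by blast
  have ge1: "x u \<ge> 1" if u: "u \<in> ?U" for u
  proof -
    obtain i where "x u = of_int i"
      using u x(2) by (auto elim: Ints_cases)
    then show ?thesis using u by simp
  qed
  have "(\<Sum>u\<in>B. of_int (c u)) \<le> (\<Sum>u\<in>B. of_int (c u) * x u)"
  proof (rule sum_mono)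
    fix u assume "u \<in> B"
    then have "u \<in> ?U" using B(2) by blast
    then show "of_int (c u) \<le> of_int (c u) * x u"
      using mult_left_mono[OF ge1, of u "of_int (c u)"] assms(3) by auto
  qed
  also have "\<dots> \<le> (\<Sum>u\<in>V. of_int (c u) * x u)"
    using B(2) assms(3) feas fin
    by (intro sum_mono2) (auto simp: covering_feasible_def)
  also have "\<dots> \<le> (\<Sum>u\<in>V. of_int (c u) * w u)"
    using x(1) assms(4) by (simp add: covering_optimal_def)
  finally show thesis
    using that B(1) by blast
qed

text \<open>
  Idealness speaks of integral weights only, whereas \<open>x\<close> is real. The weights \<open>\<lceil>N * x u\<rceil>\<close> for an
  integer \<open>N\<close> differ from \<open>N * x u\<close> by at most 1 in each entry, so that the claim holds up to an
  error of order \<open>1 / N\<close>, for every \<open>N\<close>.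
\<close>

lemma ideal_clutter_feasible_product:
  assumes "clutter V \<C>" "ideal_clutter V \<C>"
    and w: "covering_feasible V \<C> w" and x: "covering_feasible V (blocker V \<C>) x"
  shows "(\<Sum>u\<in>V. x u * w u) \<ge> 1"
proof -
  let ?P = "\<Sum>u\<in>V. x u * w u" and ?W = "\<Sum>u\<in>V. w u"
  have x0: "x u \<ge> 0" and w0: "w u \<ge> 0" if "u \<in> V" for u
    using that w x by (auto simp: covering_feasible_def)
  have approx: "real N * (1 - ?P) \<le> ?W" for N
  proof -
    let ?c = "\<lambda>u. \<lceil>real N * x u\<rceil>"
    have "\<forall>u\<in>V. ?c u \<ge> 0"
    proof
      fix u assume "u \<in> V"
      then have "real N * x u \<ge> 0" using x0 by simp
      then show "?c u \<ge> 0" by linarith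
    qed
    then obtain B where B: "B \<in> blocker V \<C>"
        "(\<Sum>u\<in>B. of_int (?c u)) \<le> (\<Sum>u\<in>V. of_int (?c u) * w u)"
      using ideal_clutter_min_cover_bound[OF assms(1,2) _ w] by metis
    have "real N \<le> real N * (\<Sum>u\<in>B. x u)"
      using x B(1) mult_left_mono[of 1 "\<Sum>u\<in>B. x u" "real N"] by (simp add: covering_feasible_def)
    also have "\<dots> \<le> (\<Sum>u\<in>B. of_int (?c u))"
      by (simp add: sum_distrib_left sum_mono)
    also have "\<dots> \<le> (\<Sum>u\<in>V. of_int (?c u) * w u)"
      by (rule B(2))
    also have "\<dots> \<le> (\<Sum>u\<in>V. (real N * x u + 1) * w u)"
    proof (intro sum_mono mult_right_mono)
      show "of_int (?c u) \<le> real N * x u + 1" for u by linarith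
    qed (use w0 in auto)
    also have "\<dots> = real N * ?P + ?W"
      by (simp add: algebra_simps sum.distrib sum_distrib_left)
    finally show ?thesis by (simp add: algebra_simps)
  qed
  show ?thesis
  proof (rule ccontr)
    assume "\<not> ?thesis"
    then have "1 - ?P > 0" by simp
    from ex_less_of_nat_mult[OF this, of ?W] approx show False
      by (auto simp: not_less[symmetric])
  qed
qed

text \<open>
  For \<open>\<C> = {}\<close> the blocker is \<open>{{}}\<close>, whose linear program is infeasible; hence the second premise.
\<close>

theorem ideal_clutter_blocker:
  assumes cl: "clutter V \<C>" and ne: "\<C> \<noteq> {}" and ideal: "ideal_clutter V \<C>"
  shows "ideal_clutter V (blocker V \<C>)"
  unfolding ideal_clutter_def
proof (intro allI impI)
  fix w :: "'a \<Rightarrow> int"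
  assume w0: "\<forall>u\<in>V. w u \<ge> 0"
  have fin: "finite V" and sub: "\<And>A. A \<in> \<C> \<Longrightarrow> A \<subseteq> V"
    using cl by (auto simp: clutter_def)
  have finC: "finite \<C>"
    using fin cl by (auto simp: clutter_def intro: finite_subset[of _ "Pow V"])
  let ?wt = "\<lambda>A. \<Sum>u\<in>A. real_of_int (w u)"
  obtain A where A: "A \<in> \<C>" and least: "\<And>D. D \<in> \<C> \<Longrightarrow> ?wt A \<le> ?wt D"
    using ex_min_if_finite[of "?wt ` \<C>"] finC ne by (auto simp: not_less)
  have AV: "A \<subseteq> V" by (rule sub[OF A])
  \<comment> \<open>The minimum-weight member of \<open>\<C>\<close>, as a 0/1 vector, is the integral optimum.\<close>
  let ?x = "\<lambda>u. if u \<in> A then 1 else 0 :: real"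
  have feas: "covering_feasible V (blocker V \<C>) ?x"
    unfolding covering_feasible_def
  proof (intro conjI ballI)
    fix B assume "B \<in> blocker V \<C>"
    then have B: "B \<subseteq> V" "A \<inter> B \<noteq> {}"
      using A blocker_imp_cover[of B V \<C>] by (auto simp: cover_def)
    then obtain a where a: "a \<in> A" "a \<in> B" by blast
    have "?x a \<le> (\<Sum>u\<in>B. ?x u)"
      by (rule member_le_sum) (use a B fin in \<open>auto intro: finite_subset\<close>)
    then show "(\<Sum>u\<in>B. ?x u) \<ge> 1" using a by simp
  qed simp
  have weight_x: "(\<Sum>u\<in>V. of_int (w u) * ?x u) = ?wt A"
    using fin AV by (simp add: if_distrib sum.If_cases Int_absorb1 cong: if_cong)
  have opt: "?wt A \<le> (\<Sum>u\<in>V. of_int (w u) * y u)"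
    if y: "covering_feasible V (blocker V \<C>) y" for y
  proof (cases "?wt A \<le> 0")
    case True
    also have "0 \<le> (\<Sum>u\<in>V. of_int (w u) * y u)"
      using w0 y by (intro sum_nonneg mult_nonneg_nonneg) (auto simp: covering_feasible_def)
    finally show ?thesis .
  next
    case False
    have "covering_feasible V \<C> (\<lambda>u. of_int (w u) / ?wt A)"
      using False w0 least by (auto simp: covering_feasible_def sum_divide_distrib[symmetric])
    from ideal_clutter_feasible_product[OF cl ideal this y] False
    show ?thesis
      by (simp add: sum_divide_distrib[symmetric] mult.commute)
  qed
  show "\<exists>x. covering_optimal V (blocker V \<C>) w x \<and> (\<forall>u\<in>V. x u \<in> \<int>)"
    using feas opt weight_x by (intro exI[of _ ?x]) (auto simp: covering_optimal_def)
qed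

section \<open>Intersecting families and colourings of the blocker\<close>

lemma kwise_intersecting_not_colourable:
  assumes "finite V" "kwise_intersecting k V \<C>"
  shows "\<not> proper_colouring k V (blocker V \<C>) f"
proof
  assume f: "proper_colouring k V (blocker V \<C>) f"
  have "\<forall>c\<in>{..<k}. \<exists>A. A \<in> \<C> \<and> A \<inter> {v\<in>V. f v = c} = {}"
  proof
    fix c assume "c \<in> {..<k}"
    then have "\<not> (\<exists>B\<in>blocker V \<C>. B \<subseteq> {v\<in>V. f v = c})"
      using f by (auto simp: proper_colouring_def)
    then show "\<exists>A. A \<in> \<C> \<and> A \<inter> {v\<in>V. f v = c} = {}"
      using no_blocker_member_imp_disjoint_member[OF assms(1), of "{v\<in>V. f v = c}" \<C>] by blast
  qed
  then obtain g where g: "\<And>c. c < k \<Longrightarrow> g c \<in> \<C>" "\<And>c. c < k \<Longrightarrow> g c \<inter> {v\<in>V. f v = c} = {}"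
    by (metis lessThan_iff)
  have "g ` {..<k} \<subseteq> \<C>" "finite (g ` {..<k})" "card (g ` {..<k}) \<le> k"
    using g(1) card_image_le[of "{..<k}" g] by auto
  then obtain v where v: "v \<in> V" "\<forall>A\<in>g ` {..<k}. v \<in> A"
    using assms(2) unfolding kwise_intersecting_def by blast
  have "f v < k"
    using f v(1) by (simp add: proper_colouring_def)
  then show False
    using g(2)[of "f v"] v by auto
qed

lemma kwise_intersecting_blocker_card:
  assumes fin: "finite V" and int: "kwise_intersecting k V \<C>" and B: "B \<in> blocker V \<C>"
  shows "card B > 1"
proof (rule ccontr)
  have cov: "B \<subseteq> V" "\<forall>A\<in>\<C>. A \<inter> B \<noteq> {}"
    using blocker_imp_cover[OF B] by (auto simp: cover_def)
  \<comment> \<open>The empty subfamily of \<open>\<C>\<close> has a common element as well, so \<open>V\<close> is not empty.\<close>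
  obtain z where z: "z \<in> V"
    using int unfolding kwise_intersecting_def by (metis card.empty empty_subsetI finite.emptyI le0)
  assume "\<not> card B > 1"
  moreover have "finite B"
    using cov(1) fin by (rule finite_subset)
  ultimately have "B = {} \<or> (\<exists>v. B = {v})"
    by (metis card_0_eq card_1_singletonE less_one linorder_neqE_nat)
  then have "\<exists>v\<in>V. \<forall>A\<in>\<C>. v \<in> A"
    using cov z by auto
  then show False
    using int by (simp add: kwise_intersecting_def)
qed

text \<open>
  If \<open>S\<close> were at most \<open>k\<close> minimal covers without a common element, colour each \<open>v\<close> by (the index
  of) a cover in \<open>S\<close> that misses \<open>v\<close>: a monochromatic member would be disjoint from a cover.
\<close>

lemma blocker_kwise_intersecting:
  assumes cl: "clutter V \<C>" and big: "\<And>A. A \<in> \<C> \<Longrightarrow> card A > 1"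
    and uncol: "\<not> (\<exists>f. proper_colouring k V \<C> f)"
  shows "kwise_intersecting k V (blocker V \<C>)"
  unfolding kwise_intersecting_def
proof (intro conjI allI impI notI)
  fix S assume S: "S \<subseteq> blocker V \<C> \<and> finite S \<and> card S \<le> k"
  show "\<exists>v\<in>V. \<forall>B\<in>S. v \<in> B"
  proof (rule ccontr)
    assume "\<not> (\<exists>v\<in>V. \<forall>B\<in>S. v \<in> B)"
    then obtain m where m: "\<And>v. v \<in> V \<Longrightarrow> m v \<in> S" "\<And>v. v \<in> V \<Longrightarrow> v \<notin> m v"
      by metis
    obtain g where g: "g ` S \<subseteq> {..<k}" "inj_on g S"
      using S card_le_inj[of S "{..<k}"] by auto
    have "proper_colouring k V \<C> (g \<circ> m)"
      unfolding proper_colouring_def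
    proof (intro conjI ballI notI)
      show "(g \<circ> m) v < k" if "v \<in> V" for v
        using that m(1) g(1) by auto
    next
      fix A assume A: "A \<in> \<C>" and "\<exists>c<k. \<forall>v\<in>A. (g \<circ> m) v = c"
      then obtain c where c: "\<And>v. v \<in> A \<Longrightarrow> g (m v) = c" by auto
      have AV: "A \<subseteq> V" using cl A by (auto simp: clutter_def)
      have "A \<noteq> {}" using big[OF A] by auto
      then obtain a where a: "a \<in> A" by blast
      have "m v = m a" if "v \<in> A" for v
        using that a AV c m(1) g(2) by (metis inj_onD subsetD)
      then have "A \<inter> m a = {}"
        using AV m(2) by fastforce
      moreover have "cover V \<C> (m a)"
        using a AV m(1) S blocker_imp_cover by blast
      ultimately show False
        using A by (auto simp: cover_def)
    qed
    then show False using uncol by blast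
  qed
next
  have fin: "finite V" using cl by (simp add: clutter_def)
  assume "\<exists>v\<in>V. \<forall>B\<in>blocker V \<C>. v \<in> B"
  then obtain v where v: "v \<in> V" "\<forall>B\<in>blocker V \<C>. v \<in> B" by blast
  \<comment> \<open>As \<open>V - {v}\<close> contains no minimal cover, a member lies inside \<open>{v}\<close>.\<close>
  obtain A where A: "A \<in> \<C>" "A \<inter> (V - {v}) = {}"
    using no_blocker_member_imp_disjoint_member[OF fin, of "V - {v}" \<C>] v(2) by blast
  then have "A \<subseteq> {v}" using cl by (auto simp: clutter_def)
  then have "card A \<le> 1" using card_mono[of "{v}" A] by simp
  then show False using big[OF A(1)] by simp
qed

section \<open>Colourability and the chromatic number\<close>

lemma proper_colouring_mono:
  assumes "proper_colouring j V \<C> f" "j \<le> k" "\<And>A. A \<in> \<C> \<Longrightarrow> A \<subseteq> V \<and> A \<noteq> {}"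
  shows "proper_colouring k V \<C> f"
  using assms unfolding proper_colouring_def by (metis all_not_in_conv order_less_le_trans subsetD)

lemma ex_proper_colouring:
  assumes cl: "clutter V \<C>" and big: "\<And>A. A \<in> \<C> \<Longrightarrow> card A > 1"
  shows "\<exists>f. proper_colouring (max 2 (card V)) V \<C> f"
proof -
  have "finite V" using cl by (simp add: clutter_def)
  then obtain f where f: "bij_betw f V {0..<card V}"
    using ex_bij_betw_finite_nat by blast
  have "proper_colouring (max 2 (card V)) V \<C> f"
    unfolding proper_colouring_def
  proof (intro conjI ballI notI)
    show "f v < max 2 (card V)" if "v \<in> V" for v
      using bij_betwE[OF f] that by (auto simp: less_max_iff_disj)
  next
    fix A assume A: "A \<in> \<C>" and "\<exists>c<max 2 (card V). \<forall>v\<in>A. f v = c"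
    then obtain c where c: "\<forall>v\<in>A. f v = c" by blast
    have "A \<subseteq> V" using cl A by (auto simp: clutter_def)
    then have "inj_on f A"
      using f by (meson bij_betw_def inj_on_subset)
    moreover have "f ` A \<subseteq> {c}" using c by auto
    ultimately have "card A \<le> 1"
      using card_inj_on_le[of f A "{c}"] by simp
    then show False using big[OF A] by simp
  qed
  then show ?thesis by blast
qed

lemma chromatic_number_le_iff:
  assumes cl: "clutter V \<C>" and big: "\<And>A. A \<in> \<C> \<Longrightarrow> card A > 1" and k: "k \<ge> 2"
  shows "chromatic_number V \<C> \<le> k \<longleftrightarrow> (\<exists>f. proper_colouring k V \<C> f)"
proof
  let ?P = "\<lambda>j. j \<ge> 2 \<and> (\<exists>f. proper_colouring j V \<C> f)"
  assume le: "chromatic_number V \<C> \<le> k"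
  have "?P (max 2 (card V))"
    using ex_proper_colouring[OF cl big] by simp
  then have "?P (chromatic_number V \<C>)"
    unfolding chromatic_number_def by (rule LeastI)
  then obtain f where f: "proper_colouring (chromatic_number V \<C>) V \<C> f" by blast
  have "A \<subseteq> V \<and> A \<noteq> {}" if "A \<in> \<C>" for A
    using cl big[OF that] that by (auto simp: clutter_def)
  then show "\<exists>f. proper_colouring k V \<C> f"
    using proper_colouring_mono[OF f le] by blast
next
  assume "\<exists>f. proper_colouring k V \<C> f"
  then show "chromatic_number V \<C> \<le> k"
    unfolding chromatic_number_def using k by (intro Least_le) simp
qed

section \<open>The equivalence\<close>

theorem proposition11:
  fixes k :: nat
  assumes "k \<ge> 4"
  shows "(\<forall>(V :: 'a set) \<C>. clutter V \<C> \<and> kwise_intersecting k V \<C> \<longrightarrow> \<not> ideal_clutter V \<C>)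
     \<longleftrightarrow> (\<forall>(V :: 'a set) \<C>. clutter V \<C> \<and> ideal_clutter V \<C> \<and> \<not> (\<exists>A\<in>\<C>. card A \<le> 1)
            \<longrightarrow> chromatic_number V \<C> \<le> k)"
proof (intro iffI allI impI)
  fix V :: "'a set" and \<C>
  assume a: "\<forall>(V :: 'a set) \<C>. clutter V \<C> \<and> kwise_intersecting k V \<C> \<longrightarrow> \<not> ideal_clutter V \<C>"
    and "clutter V \<C> \<and> ideal_clutter V \<C> \<and> \<not> (\<exists>A\<in>\<C>. card A \<le> 1)"
  then have cl: "clutter V \<C>" and ideal: "ideal_clutter V \<C>"
    and big: "\<And>A. A \<in> \<C> \<Longrightarrow> card A > 1"
    by (auto simp: not_le)
  have fin: "finite V" using cl by (simp add: clutter_def)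
  have "\<exists>f. proper_colouring k V \<C> f"
  proof (rule ccontr)
    assume uncol: "\<not> (\<exists>f. proper_colouring k V \<C> f)"
    have "\<C> \<noteq> {}"
    proof
      assume "\<C> = {}"
      then have "proper_colouring k V \<C> (\<lambda>_. 0)"
        using assms by (simp add: proper_colouring_def)
      then show False using uncol by blast
    qed
    then show False
      using a clutter_blocker[OF fin] ideal_clutter_blocker[OF cl _ ideal]
        blocker_kwise_intersecting[OF cl big uncol] by blast
  qed
  then show "chromatic_number V \<C> \<le> k"
    using chromatic_number_le_iff[OF cl big] assms by simp
next
  fix V :: "'a set" and \<C>
  assume b: "\<forall>(V :: 'a set) \<C>. clutter V \<C> \<and> ideal_clutter V \<C> \<and> \<not> (\<exists>A\<in>\<C>. card A \<le> 1)
            \<longrightarrow> chromatic_number V \<C> \<le> k"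
    and "clutter V \<C> \<and> kwise_intersecting k V \<C>"
  then have cl: "clutter V \<C>" and int: "kwise_intersecting k V \<C>" by auto
  have fin: "finite V" using cl by (simp add: clutter_def)
  show "\<not> ideal_clutter V \<C>"
  proof
    assume ideal: "ideal_clutter V \<C>"
    have big: "card B > 1" if "B \<in> blocker V \<C>" for B
      by (rule kwise_intersecting_blocker_card[OF fin int that])
    have "\<C> \<noteq> {}"
    proof
      assume "\<C> = {}"
      then have "{} \<in> blocker V \<C>" by (simp add: blocker_def cover_def)
      from big[OF this] show False by simp
    qed
    then have "ideal_clutter V (blocker V \<C>)"
      by (rule ideal_clutter_blocker[OF cl _ ideal])
    then have "chromatic_number V (blocker V \<C>) \<le> k"
      using b clutter_blocker[OF fin] big by (auto simp: not_le)
    then have "\<exists>f. proper_colouring k V (blocker V \<C>) f"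
      using chromatic_number_le_iff[OF clutter_blocker[OF fin] big] assms by simp
    then show False
      using kwise_intersecting_not_colourable[OF fin int] by blast
  qed
qed

end
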